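(* Let $n\ge1$. For each $\sigma\in\mathcal{S}_n$, the distribution of the number of descents on $\mathcal{C}_n^\sigma$ is symmetric, in the sense that $$|\{\pi\in\mathcal{C}_n^\sigma:\mathrm{des}(\pi)-\mathrm{des}(\sigma)=r\}|=|\{\pi\in\mathcal{C}_n^\sigma:\mathrm{des}(\pi)-\mathrm{des}(\sigma)=n-1-r\}|$$ for all integers $r$.
   Context: Let $[n]=\{1,\dots,n\}$ and let $[n]\sqcup[n]=\{1,1,2,2,\dots,n,n\}$ be the multiset with two copies of each element of $[n]$. A permutation $\pi=\pi_1\pi_2\dots\pi_{2n}$ of $[n]\sqcup[n]$ is nonnesting if there do not exist $i<j<\ell<m$ with $\pi_i=\pi_m$ and $\pi_j=\pi_\ell$; equivalently, the subsequence of $\pi$ formed by the first (leftmost) copy of each entry coincides with the subsequence formed by the second copy of each entry. $\mathcal{C}_n$ denotes the set of nonnesting permutations of $[n]\sqcup[n]$, and for $\pi\in\mathcal{C}_n$ this common subsequence, a permutation in $\mathcal{S}_n$ (the set of permutations of $[n]$ in one-line notation), is denoted $s(\pi)$. For $\sigma\in\mathcal{S}_n$, $\mathcal{C}_n^\sigma=\{\pi\in\mathcal{C}_n:s(\pi)=\sigma\}$. For a word $\pi=\pi_1\dots\pi_m$ of positive integers, $\mathrm{des}(\pi)=|\{i\in[m-1]:\pi_i>\pi_{i+1}\}|$. *)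

theory Defs
  imports "HOL-Combinatorics.Multiset_Permutations"
begin

(* Words are lists, with positions counted from 0. *)

definition nonnesting :: "'a list \<Rightarrow> bool" where
  "nonnesting xs \<longleftrightarrow>
     \<not> (\<exists>i j l m. i < j \<and> j < l \<and> l < m \<and> m < length xs \<and> xs ! i = xs ! m \<and> xs ! j = xs ! l)"

definition nonnesting_perms :: "nat \<Rightarrow> nat list set" where
  "nonnesting_perms n =
     {\<pi> \<in> permutations_of_multiset (mset_set {1..n} + mset_set {1..n}). nonnesting \<pi>}"

(* The subsequence of leftmost copies. The library's remdups would keep the rightmost
   ones instead; on nonnesting permutations the two subsequences coincide. *)
definition first_copies :: "'a list \<Rightarrow> 'a list" where
  "first_copies xs = nths xs {i. i < length xs \<and> xs ! i \<notin> set (take i xs)}"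

definition nonnesting_perms_over :: "nat \<Rightarrow> nat list \<Rightarrow> nat list set" where
  "nonnesting_perms_over n \<sigma> = {\<pi> \<in> nonnesting_perms n. first_copies \<pi> = \<sigma>}"

definition des :: "'a::linorder list \<Rightarrow> nat" where
  "des xs = card {i. Suc i < length xs \<and> xs ! i > xs ! Suc i}"

end

theory Submission
  imports Defs
begin

text \<open>A nonnesting permutation over \<open>\<sigma>\<close> is a Dyck path whose \<open>i\<close>-th up step and \<open>i\<close>-th down step
  both carry the letter \<open>\<sigma>\<^sub>i\<close>. Two moves on \<open>\<sigma>\<close> preserve the distribution of
  \<open>des \<pi> - des \<sigma>\<close>. Exchanging two consecutive values at non-adjacent positions is compensated by
  exchanging the two corresponding steps of the path where they are adjacent. Turning the largest
  value into the smallest one changes \<open>des \<pi>\<close> only through the first and the last letter, which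
  \<open>\<pi>\<close> and \<open>\<sigma>\<close> share, so the difference does not change at all. Like the conjugation of Coxeter
  elements of a tree, these moves connect any \<open>\<sigma>\<close> with the decreasing permutation, for which
  the difference is \<open>n\<close> minus the number of peaks; and the number of paths with \<open>k\<close> peaks is a
  Narayana number, which is symmetric under \<open>k \<mapsto> n + 1 - k\<close>.\<close>

section \<open>Words of Dyck paths\<close>

text \<open>A step \<open>True\<close> writes the next first copy, a step \<open>False\<close> the next second copy; the
  letters are positions in \<open>\<sigma>\<close>, with \<open>a\<close> first and \<open>b\<close> second copies already written.\<close>

fun letters :: "nat \<Rightarrow> nat \<Rightarrow> bool list \<Rightarrow> nat list" where
  "letters a b [] = []"
| "letters a b (True # p) = a # letters (Suc a) b p"
| "letters a b (False # p) = b # letters a (Suc b) p"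

fun dyck :: "nat \<Rightarrow> nat \<Rightarrow> nat \<Rightarrow> bool list \<Rightarrow> bool" where
  "dyck n a b [] \<longleftrightarrow> a = n \<and> b = n"
| "dyck n a b (True # p) \<longleftrightarrow> dyck n (Suc a) b p"
| "dyck n a b (False # p) \<longleftrightarrow> b < a \<and> dyck n a (Suc b) p"

text \<open>The relation is a parameter because letters are positions in \<sigma>: changing \<sigma>
  then changes only how letters are compared, while the words of the paths stay fixed.\<close>

fun adj_count :: "('a \<Rightarrow> 'a \<Rightarrow> bool) \<Rightarrow> 'a list \<Rightarrow> nat" where
  "adj_count R (x # y # zs) = of_bool (R x y) + adj_count R (y # zs)"
| "adj_count R _ = 0"

lemma des_Cons_Cons: "des (x # y # zs) = of_bool (x > y) + des (y # zs)"
proof -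
  let ?D = "\<lambda>xs. {i. Suc i < length xs \<and> xs ! i > xs ! Suc i}"
  have "?D (x # y # zs) = (if x > y then {0} else {}) \<union> Suc ` ?D (y # zs)"
  proof (rule set_eqI)
    fix i show "i \<in> ?D (x # y # zs) \<longleftrightarrow> i \<in> (if x > y then {0} else {}) \<union> Suc ` ?D (y # zs)"
      by (cases i) auto
  qed
  moreover have "finite (?D (y # zs))"
    by (rule finite_subset[of _ "{..<length (y # zs)}"]) auto
  ultimately show ?thesis
    unfolding des_def by (auto simp: card_image card_insert_if)
qed

lemma des_map_eq_adj_count: "des (map f xs) = adj_count (\<lambda>x y. f x > f y) xs"
  by (induction xs rule: induct_list012) (simp_all add: des_Cons_Cons, simp_all add: des_def)

lemma adj_count_cong:
  assumes "\<And>x y. x \<in> set xs \<Longrightarrow> y \<in> set xs \<Longrightarrow> R x y = S x y"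
  shows "adj_count R xs = adj_count S xs"
  using assms by (induction R xs rule: adj_count.induct) auto

lemma length_letters [simp]: "length (letters a b p) = length p"
  by (induction a b p rule: letters.induct) auto

lemma letters_eq_Nil_iff [simp]: "letters a b p = [] \<longleftrightarrow> p = []"
  by (metis length_0_conv length_letters)

lemma letters_append:
  "letters a b (p @ q) =
     letters a b p @ letters (a + count_list p True) (b + count_list p False) q"
  by (induction a b p rule: letters.induct) auto

lemma count_letters:
  "count_list (letters a b p) c =
     of_bool (a \<le> c \<and> c < a + count_list p True) + of_bool (b \<le> c \<and> c < b + count_list p False)"
  (is "_ = ?L a b p")
proof (induction a b p rule: letters.induct)
  case (2 a b p)
  have "?L a b (True # p) = of_bool (a = c) + ?L (Suc a) b p"
    by (cases "a = c") (simp_all add: Suc_le_eq order_less_le)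
  with 2 show ?case by (cases "a = c") simp_all
next
  case (3 a b p)
  have "?L a b (False # p) = of_bool (b = c) + ?L a (Suc b) p"
    by (cases "b = c") (simp_all add: Suc_le_eq order_less_le)
  with 3 show ?case by (cases "b = c") simp_all
qed simp

lemma set_letters:
  "set (letters a b p) = {a..<a + count_list p True} \<union> {b..<b + count_list p False}"
proof (rule set_eqI)
  fix c
  have "c \<in> set (letters a b p) \<longleftrightarrow> count_list (letters a b p) c \<noteq> 0"
    by (simp add: count_list_0_iff)
  then show "c \<in> set (letters a b p) \<longleftrightarrow>
      c \<in> {a..<a + count_list p True} \<union> {b..<b + count_list p False}"
    by (simp add: count_letters)
qed

lemma letters_nth:
  "i < length p \<Longrightarrow>
     letters a b p ! i =
       (if p ! i then a + count_list (take i p) True else b + count_list (take i p) False)"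
proof (induction a b p arbitrary: i rule: letters.induct)
qed (auto simp: less_Suc_eq_0_disj)

lemma all_le_Suc_iff: "(\<forall>i \<le> Suc m. P i) \<longleftrightarrow> P 0 \<and> (\<forall>i \<le> m. P (Suc i))"
  by (metis Suc_le_mono not0_implies_Suc zero_le)

lemma dyck_iff:
  assumes "b \<le> a"
  shows "dyck n a b p \<longleftrightarrow>
    a + count_list p True = n \<and> b + count_list p False = n \<and>
    (\<forall>i \<le> length p. b + count_list (take i p) False \<le> a + count_list (take i p) True)"
  using assms
proof (induction n a b p rule: dyck.induct)
  case (2 n a b p)
  then show ?case by (simp add: all_le_Suc_iff)
next
  case (3 n a b p)
  show ?case
  proof (cases "b < a")
    case True
    with 3 show ?thesis by (simp add: all_le_Suc_iff)
  next
    case False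
    then have "\<not> (\<forall>i \<le> length (False # p).
        b + count_list (take i (False # p)) False \<le> a + count_list (take i (False # p)) True)"
      by (auto intro!: exI[of _ 1])
    with False show ?thesis by (simp del: length_Cons)
  qed
qed simp

lemma dyck_le: "dyck n a b p \<Longrightarrow> b \<le> a \<Longrightarrow> a \<le> n"
  by (auto simp: dyck_iff)

lemma length_dyck: "dyck n a b p \<Longrightarrow> a + b + length p = 2 * n"
  by (induction n a b p rule: dyck.induct) auto

lemma finite_dyck: "finite {p. dyck n a b p}"
proof (rule finite_subset)
  show "{p. dyck n a b p} \<subseteq> {p. set p \<subseteq> UNIV \<and> length p \<le> 2 * n}"
    using length_dyck by force
qed (rule finite_lists_length_le, simp)

text \<open>The first letter reveals the first step: a down step requires b < a, so it writes a
  letter different from the a of an up step.\<close>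

lemma letters_inj:
  assumes "dyck n a b p" "dyck n a b q" "letters a b p = letters a b q"
  shows "p = q"
  using assms
proof (induction n a b p arbitrary: q rule: dyck.induct)
  case (1 n a b)
  then show ?case by (metis length_letters length_0_conv)
next
  case (2 n a b p)
  then obtain x q' where q: "q = x # q'" by (cases q) auto
  show ?case using 2 unfolding q by (cases x) auto
next
  case (3 n a b p)
  then obtain x q' where q: "q = x # q'" by (cases q) auto
  show ?case using 3 unfolding q by (cases x) auto
qed

section \<open>Nonnesting permutations as Dyck paths\<close>

lemma first_copies_snoc:
  "first_copies (xs @ [x]) = first_copies xs @ (if x \<in> set xs then [] else [x])"
proof -
  let ?I = "\<lambda>xs. {i. i < length xs \<and> xs ! i \<notin> set (take i xs)}"
  have "nths xs (?I (xs @ [x])) = nths xs (?I xs)"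
    unfolding nths_def by (intro arg_cong[where f = "map fst"] filter_cong)
      (auto simp: set_zip nth_append)
  then show ?thesis
    by (simp add: first_copies_def nths_append nth_append)
qed

lemma first_copies_append: "\<exists>zs. first_copies (xs @ ys) = first_copies xs @ zs"
proof (induction ys rule: rev_induct)
  case (snoc y ys)
  then obtain zs where "first_copies (xs @ ys) = first_copies xs @ zs" by blast
  then have "first_copies (xs @ ys @ [y]) =
      first_copies xs @ zs @ (if y \<in> set (xs @ ys) then [] else [y])"
    using first_copies_snoc[of "xs @ ys" y] by simp
  then show ?case by blast
qed simp

lemma first_copies_map:
  assumes "inj_on f (set xs)"
  shows "first_copies (map f xs) = map f (first_copies xs)"
  using assms
proof (induction xs rule: rev_induct)
  case (snoc x xs)
  then have "inj_on f (set xs)" "f x \<in> f ` set xs \<longleftrightarrow> x \<in> set xs"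
    by (auto simp: inj_on_def)
  with snoc.IH show ?case by (simp add: first_copies_snoc)
qed (simp add: first_copies_def)

lemma nonnesting_map:
  assumes "inj_on f (set xs)"
  shows "nonnesting (map f xs) \<longleftrightarrow> nonnesting xs"
proof -
  have *: "f (xs ! i) = f (xs ! j) \<longleftrightarrow> xs ! i = xs ! j" if "i < length xs" "j < length xs" for i j
    using assms that by (simp add: inj_on_eq_iff)
  show ?thesis unfolding nonnesting_def
    by (intro arg_cong[where f = Not] ex_cong1 conj_cong refl) (simp_all add: *)
qed

text \<open>The Dyck condition without prescribed end point, so that it passes to prefixes and
  allows induction from the right.\<close>

definition ballot :: "bool list \<Rightarrow> bool" where
  "ballot p \<longleftrightarrow> (\<forall>i \<le> length p. count_list (take i p) False \<le> count_list (take i p) True)"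

lemma dyck_iff_ballot:
  "dyck n 0 0 p \<longleftrightarrow> count_list p True = n \<and> count_list p False = n \<and> ballot p"
  by (simp add: dyck_iff ballot_def)

lemma ballot_Nil: "ballot []"
  by (simp add: ballot_def)

lemma ballot_snoc:
  "ballot (p @ [x]) \<longleftrightarrow>
     ballot p \<and> count_list (p @ [x]) False \<le> count_list (p @ [x]) True"
  unfolding ballot_def by (auto simp: le_Suc_eq)

lemma ballot_le: "ballot p \<Longrightarrow> count_list p False \<le> count_list p True"
  by (auto simp: ballot_def)

lemma first_copies_letters:
  "ballot p \<Longrightarrow> first_copies (letters 0 0 p) = [0..<count_list p True]"
proof (induction p rule: rev_induct)
  case (snoc x p)
  then show ?case
    using ballot_le[of p]
    by (cases x) (auto simp: ballot_snoc letters_append first_copies_snoc set_letters)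
qed (simp add: first_copies_def)

text \<open>Supplies the two left positions of a forbidden nesting in
  \<open>nonnesting_prefix\<close>.\<close>

lemma letters_ordered:
  "ballot p \<Longrightarrow> b < c \<Longrightarrow> c < count_list p True \<Longrightarrow>
    \<exists>i j. i < j \<and> j < length p \<and> letters 0 0 p ! i = b \<and> letters 0 0 p ! j = c"
proof (induction p rule: rev_induct)
  case (snoc x p)
  show ?case
  proof (cases "c < count_list p True")
    case True
    with snoc obtain i j where "i < j" "j < length p" "letters 0 0 p ! i = b" "letters 0 0 p ! j = c"
      by (auto simp: ballot_snoc)
    then show ?thesis
      by (intro exI[of _ i] exI[of _ j]) (auto simp: letters_append nth_append)
  next
    case False
    with snoc.prems have x: "x" "c = count_list p True" by (auto split: if_splits)
    with snoc.prems have "b \<in> set (letters 0 0 p)" by (simp add: set_letters)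
    then obtain i where "i < length p" "letters 0 0 p ! i = b"
      by (auto simp: in_set_conv_nth)
    with x show ?thesis
      by (intro exI[of _ i] exI[of _ "length p"]) (auto simp: letters_append nth_append)
  qed
qed simp

lemma count_list_map_inj_on:
  assumes "inj_on f A" "set xs \<subseteq> A" "x \<in> A"
  shows "count_list (map f xs) (f x) = count_list xs x"
  using assms(2) by (induction xs) (use assms(1,3) in \<open>auto simp: inj_on_def\<close>)

lemma count_take_less:
  assumes "i < j" "j \<le> length p" "p ! i = x"
  shows "count_list (take i p) x < count_list (take j p) x"
proof -
  have "take j p = take (Suc i) p @ take (j - Suc i) (drop (Suc i) p)"
    using assms(1) take_add[of "Suc i" "j - Suc i" p] by simp
  also have "take (Suc i) p = take i p @ [x]"
    using assms by (simp add: take_Suc_conv_app_nth)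
  finally show ?thesis by simp
qed

text \<open>Of two equal letters the left one comes from an up step and the right one from a down
  step. Both kinds of steps write increasing letters, so in a nesting the inner letter would be
  larger than the outer one by the left pair and smaller by the right pair.\<close>

lemma nonnesting_letters:
  assumes "ballot p"
  shows "nonnesting (letters 0 0 p)"
  unfolding nonnesting_def
proof (safe)
  let ?w = "letters 0 0 p"
  have split: "p ! i \<and> \<not> p ! m" if "i < m" "m < length p" "?w ! i = ?w ! m" for i m
  proof -
    have "take m p = take (Suc i) p @ take (m - Suc i) (drop (Suc i) p)"
      using that take_add[of "Suc i" "m - Suc i" p] by simp
    moreover have "take (Suc i) p = take i p @ [p ! i]"
      using that by (simp add: take_Suc_conv_app_nth)
    moreover have "count_list (take (Suc i) p) False \<le> count_list (take (Suc i) p) True"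
      using assms that unfolding ballot_def by (metis Suc_leI less_imp_le_nat order_less_trans)
    ultimately show ?thesis
      using that by (cases "p ! i"; cases "p ! m") (auto simp: letters_nth)
  qed
  fix i j l m
  assume *: "i < j" "j < l" "l < m" "m < length ?w" "?w ! i = ?w ! m" "?w ! j = ?w ! l"
  with split[of i m] split[of j l] have "p ! i" "\<not> p ! m" "p ! j" "\<not> p ! l" by auto
  then have "?w ! i < ?w ! j" "?w ! l < ?w ! m"
    using * count_take_less[of i j p True] count_take_less[of l m p False]
    by (simp_all add: letters_nth)
  with *(5,6) show False by simp
qed

text \<open>Reading \<pi> from the left decodes the path. A new letter must be the next entry of
  \<sigma>, an up step. A repeated letter must be the oldest one still lacking its second copy, a
  down step: otherwise that oldest letter would later close around the repeated one.\<close>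

lemma nonnesting_prefix:
  assumes "nonnesting \<pi>" "first_copies \<pi> = \<sigma>"
    and twice: "\<And>x. x \<in> set \<pi> \<Longrightarrow> count_list \<pi> x = 2"
    and "distinct \<sigma>" "set \<sigma> = set \<pi>"
    and "i \<le> length \<pi>"
  shows "\<exists>p. ballot p \<and> count_list p True \<le> length \<sigma> \<and> take i \<pi> = map ((!) \<sigma>) (letters 0 0 p)"
  using \<open>i \<le> length \<pi>\<close>
proof (induction i)
  case 0
  then show ?case by (intro exI[of _ "[]"]) (simp add: ballot_Nil)
next
  case (Suc i)
  then obtain p where p: "ballot p" "count_list p True \<le> length \<sigma>"
    and tk: "take i \<pi> = map ((!) \<sigma>) (letters 0 0 p)" by auto
  define a where "a = count_list p True"
  define b where "b = count_list p False"
  define x where "x = \<pi> ! i"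
  have ba: "b \<le> a" using ballot_le[OF p(1)] by (simp add: a_def b_def)
  have a: "a \<le> length \<sigma>" using p a_def by simp
  have len: "length p = i" using arg_cong[OF tk, of length] Suc.prems by simp
  have set_w: "set (letters 0 0 p) = {..<a}" using ba by (auto simp: set_letters a_def b_def)
  have inj: "inj_on ((!) \<sigma>) {..<length \<sigma>}"
    using \<open>distinct \<sigma>\<close> by (auto simp: inj_on_def nth_eq_iff_index_eq)
  have inj': "inj_on ((!) \<sigma>) (set (letters 0 0 p))"
    using inj a by (auto simp: set_w intro: inj_on_subset)
  have fc: "first_copies (take i \<pi>) = take a \<sigma>"
    unfolding tk first_copies_map[OF inj'] first_copies_letters[OF p(1)]
    using a by (intro nth_equalityI) (auto simp: a_def)
  have tkS: "take (Suc i) \<pi> = take i \<pi> @ [x]"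
    using Suc.prems by (simp add: take_Suc_conv_app_nth x_def)
  have x: "x \<in> set \<pi>" using Suc.prems by (simp add: x_def)
  have cnt: "count_list (take i \<pi>) (\<sigma> ! c) = of_bool (c < a) + of_bool (c < b)"
    if "c < length \<sigma>" for c
  proof -
    have "count_list (take i \<pi>) (\<sigma> ! c) = count_list (letters 0 0 p) c"
      unfolding tk by (rule count_list_map_inj_on[OF inj]) (use a that in \<open>auto simp: set_w\<close>)
    then show ?thesis by (simp add: count_letters a_def b_def)
  qed
  have split: "\<pi> = take i \<pi> @ x # drop (Suc i) \<pi>"
    using Suc.prems by (simp add: x_def id_take_nth_drop)
  show ?case
  proof (cases "x \<in> set (take i \<pi>)")
    case False
    obtain zs where "\<sigma> = first_copies (take (Suc i) \<pi>) @ zs"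
      using first_copies_append[of "take (Suc i) \<pi>" "drop (Suc i) \<pi>"] assms(2) by auto
    then have \<sigma>: "\<sigma> = take a \<sigma> @ x # zs"
      using False by (simp add: tkS first_copies_snoc fc)
    then have "a < length \<sigma>" using a by (metis append_take_drop_id less_le list.distinct(1) self_append_conv take_all_iff)
    moreover from this have "\<sigma> ! a = x"
      using \<sigma> by (metis length_take min.absorb2 nth_append_length a)
    ultimately show ?thesis using p ba
      by (intro exI[of _ "p @ [True]"]) (auto simp: ballot_snoc letters_append tkS tk a_def b_def)
  next
    case True
    then obtain c where c: "c < a" "x = \<sigma> ! c" by (auto simp: tk set_w)
    have "count_list \<pi> x = 2" using twice x by simp
    then have "count_list (take i \<pi>) x < 2"
      using arg_cong[OF split, of "\<lambda>xs. count_list xs x"] by simp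
    with cnt[of c] c a have "b \<le> c" by auto
    moreover have "\<not> b < c"
    proof
      assume bc: "b < c"
      then obtain k j where kj: "k < j" "j < i" "letters 0 0 p ! k = b" "letters 0 0 p ! j = c"
        using letters_ordered[OF p(1), of b c] c len by (auto simp: a_def)
      have nth: "\<pi> ! k = \<sigma> ! (letters 0 0 p ! k)" if "k < i" for k
        using arg_cong[OF tk, of "\<lambda>xs. xs ! k"] that len by simp
      have "\<sigma> ! b \<noteq> x" using bc c a \<open>distinct \<sigma>\<close> by (simp add: nth_eq_iff_index_eq)
      moreover have "count_list \<pi> (\<sigma> ! b) = 2"
        using twice bc c a assms(5) by (metis less_trans nth_mem order_less_le_trans)
      moreover have "count_list (take i \<pi>) (\<sigma> ! b) = 1" using cnt[of b] bc c a by simp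
      ultimately have "count_list (drop (Suc i) \<pi>) (\<sigma> ! b) = 1"
        using arg_cong[OF split, of "\<lambda>xs. count_list xs (\<sigma> ! b)"] by simp
      then have "\<sigma> ! b \<in> set (drop (Suc i) \<pi>)"
        by (metis count_list_0_iff zero_neq_one)
      then obtain m where "i < m" "m < length \<pi>" "\<pi> ! m = \<sigma> ! b"
        using Suc.prems by (auto simp: in_set_conv_nth)
          (metis add_Suc_right less_diff_conv add.commute less_add_Suc1)
      moreover have "\<pi> ! k = \<sigma> ! b" "\<pi> ! j = \<pi> ! i"
        using nth kj c by (auto simp: x_def)
      ultimately show False
        using \<open>nonnesting \<pi>\<close> kj unfolding nonnesting_def by metis
    qed
    ultimately have "c = b" by simp
    then show ?thesis using p c
      by (intro exI[of _ "p @ [False]"]) (auto simp: ballot_snoc letters_append tkS tk a_def b_def)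
  qed
qed

lemma bij_betw_dyck_nonnesting_perms_over:
  assumes "\<sigma> \<in> permutations_of_set {1..n}"
  shows "bij_betw (\<lambda>p. map ((!) \<sigma>) (letters 0 0 p)) {p. dyck n 0 0 p} (nonnesting_perms_over n \<sigma>)"
proof -
  have \<sigma>: "set \<sigma> = {1..n}" "distinct \<sigma>" using assms by (auto simp: permutations_of_set_def)
  then have len: "length \<sigma> = n" using distinct_card by fastforce
  have inj: "inj_on ((!) \<sigma>) {..<n}"
    using \<sigma> len by (auto simp: inj_on_def nth_eq_iff_index_eq)
  have set_letters_dyck: "set (letters 0 0 p) = {..<n}" if "dyck n 0 0 p" for p
    using that by (auto simp: dyck_iff set_letters)
  have mset_iff: "\<pi> \<in> permutations_of_multiset (mset_set {1..n} + mset_set {1..n}) \<longleftrightarrow>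
      (\<forall>x. count_list \<pi> x = (if x \<in> {1..n} then 2 else 0))" for \<pi>
    by (auto simp: permutations_of_multiset_def multiset_eq_iff count_mset_set' count_mset)
  show ?thesis
  proof (rule bij_betw_imageI)
    show "inj_on (\<lambda>p. map ((!) \<sigma>) (letters 0 0 p)) {p. dyck n 0 0 p}"
      using inj set_letters_dyck letters_inj by (intro inj_onI) (auto dest!: inj_on_map_eq_map[THEN iffD1, rotated])
  next
    show "(\<lambda>p. map ((!) \<sigma>) (letters 0 0 p)) ` {p. dyck n 0 0 p} = nonnesting_perms_over n \<sigma>"
    proof safe
      fix p assume p: "dyck n 0 0 p"
      let ?w = "letters 0 0 p"
      have inj': "inj_on ((!) \<sigma>) (set ?w)" using inj set_letters_dyck[OF p] by simp
      have "count_list (map ((!) \<sigma>) ?w) x = (if x \<in> {1..n} then 2 else 0)" for x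
      proof (cases "x \<in> {1..n}")
        case True
        then obtain c where c: "c < n" "x = \<sigma> ! c" using \<sigma> len by (metis in_set_conv_nth)
        then have "count_list (map ((!) \<sigma>) ?w) x = count_list ?w c"
          using set_letters_dyck[OF p] by (simp only:) (rule count_list_map_inj_on[OF inj], auto)
        then show ?thesis using p c True by (auto simp: count_letters dyck_iff)
      next
        case False
        then have "x \<notin> set (map ((!) \<sigma>) ?w)"
          using set_letters_dyck[OF p] \<sigma> len by auto
        with False show ?thesis by (simp only: count_list_0_iff if_False not_False_eq_True)
      qed
      moreover have "first_copies (map ((!) \<sigma>) ?w) = \<sigma>"
        using p len map_nth[of \<sigma>]
        by (simp add: first_copies_map[OF inj'] first_copies_letters dyck_iff_ballot)
      moreover have "nonnesting (map ((!) \<sigma>) ?w)"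
        using p by (simp add: nonnesting_map[OF inj'] nonnesting_letters dyck_iff_ballot)
      ultimately show "map ((!) \<sigma>) ?w \<in> nonnesting_perms_over n \<sigma>"
        by (simp add: nonnesting_perms_over_def nonnesting_perms_def mset_iff del: One_nat_def)
    next
      fix \<pi> assume "\<pi> \<in> nonnesting_perms_over n \<sigma>"
      then have \<pi>: "nonnesting \<pi>" "first_copies \<pi> = \<sigma>"
        and cnt: "\<And>x. count_list \<pi> x = (if x \<in> {1..n} then 2 else 0)"
        by (auto simp: nonnesting_perms_over_def nonnesting_perms_def mset_iff simp del: One_nat_def)
      have set\<pi>: "set \<pi> = {1..n}"
        using cnt by (metis (no_types, lifting) count_list_0_iff subsetI subset_antisym zero_neq_numeral)
      obtain p where p: "ballot p" "count_list p True \<le> length \<sigma>"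
        "\<pi> = map ((!) \<sigma>) (letters 0 0 p)"
        using nonnesting_prefix[OF \<pi>, of "length \<pi>"] cnt set\<pi> \<sigma> by auto
      have inj': "inj_on ((!) \<sigma>) (set (letters 0 0 p))"
        using inj p len ballot_le[OF p(1)] by (auto simp: set_letters intro: inj_on_subset)
      \<comment> \<open>The first copies count the up steps; the total length then leaves n down
        steps.\<close>
      have "count_list p True = n"
        using arg_cong[OF \<pi>(2), of length] len p
        by (simp add: first_copies_map[OF inj'] first_copies_letters)
      moreover have "length \<pi> = 2 * n"
      proof -
        have "length \<pi> = (\<Sum>x \<in> set \<pi>. count_list \<pi> x)" by (simp add: sum_count_set)
        also have "\<dots> = (\<Sum>x \<in> {1..n}. 2)" unfolding set\<pi> by (intro sum.cong) (auto simp: cnt)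
        finally show ?thesis by simp
      qed
      moreover have "count_list p True + count_list p False = length p"
        by (induction p) auto
      ultimately have "dyck n 0 0 p" using p by (simp add: dyck_iff_ballot)
      then show "\<pi> \<in> (\<lambda>p. map ((!) \<sigma>) (letters 0 0 p)) ` {p. dyck n 0 0 p}"
        using p by blast
    qed
  qed
qed

section \<open>Swapping values at distant positions\<close>

text \<open>Exchanges the two steps leaving the lattice point at which \<open>j\<close> is the next first copy
  and \<open>i\<close> the next second copy: the only place where the letters \<open>i\<close> and \<open>j\<close> can be adjacent
  when \<open>i + 2 \<le> j\<close>.\<close>

fun swap_corner :: "nat \<Rightarrow> nat \<Rightarrow> nat \<Rightarrow> nat \<Rightarrow> bool list \<Rightarrow> bool list" where
  "swap_corner i j a b [] = []"
| "swap_corner i j a b [x] = [x]"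
| "swap_corner i j a b (x # y # p) =
     (if a = j \<and> b = i then y # x # p
      else x # swap_corner i j (if x then Suc a else a) (if x then b else Suc b) (y # p))"

lemma length_swap_corner [simp]: "length (swap_corner i j a b p) = length p"
  by (induction i j a b p rule: swap_corner.induct) auto

lemma swap_corner_involution [simp]: "swap_corner i j a b (swap_corner i j a b p) = p"
proof (induction i j a b p rule: swap_corner.induct)
  case (3 i j a b x y p)
  show ?case
  proof (cases "a = j \<and> b = i")
    case False
    obtain z q where "swap_corner i j (if x then Suc a else a) (if x then b else Suc b) (y # p) = z # q"
      by (metis length_swap_corner length_Suc_conv length_Cons)
    with 3 False show ?thesis by auto
  qed auto
qed auto

text \<open>The corner has height j - i > 0, so a down step may be taken there first.\<close>

lemma dyck_swap_corner: "i < j \<Longrightarrow> dyck n a b (swap_corner i j a b p) \<longleftrightarrow> dyck n a b p"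
proof (induction i j a b p rule: swap_corner.induct)
  case (3 i j a b x y p)
  then show ?case by (cases x; cases y) auto
qed auto

text \<open>\<open>R\<close> and \<open>S\<close> stand for comparing values of \<sigma> before and
  after exchanging two consecutive values, at positions i and j. Consecutive values look alike from
  every third position, hence \<open>twins\<close>.\<close>

locale distant_swap =
  fixes R S :: "nat \<Rightarrow> nat \<Rightarrow> bool" and i j :: nat
  assumes dist: "i + 2 \<le> j"
    and agree: "\<And>x y. \<not> (x = i \<and> y = j) \<Longrightarrow> \<not> (x = j \<and> y = i) \<Longrightarrow> R x y = S x y"
    and twins: "\<And>x. x \<noteq> i \<Longrightarrow> x \<noteq> j \<Longrightarrow> R x i = R x j \<and> R i x = R j x"
    and swapped: "R i j = S j i" "R j i = S i j"
begin

text \<open>Here v is the letter written just before reaching (a, b). The two exclusions say that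
  the last step did not leave the corner (j, i); only after such a step can the next letter complete
  an adjacent pair of i and j.\<close>

definition compatible :: "nat \<Rightarrow> nat \<Rightarrow> nat \<Rightarrow> bool" where
  "compatible v a b \<longleftrightarrow> b \<le> a \<and> (Suc v = a \<or> Suc v = b) \<and>
     \<not> (a = Suc j \<and> b = i \<and> v = j) \<and> \<not> (a = j \<and> b = Suc i \<and> v = i)"

lemma compatible_agree:
  assumes "compatible v a b"
  shows "R v a = S v a" "b < a \<Longrightarrow> R v b = S v b"
  using assms dist by (auto simp: compatible_def intro!: agree)

lemma compatible_step:
  assumes "compatible v a b" "\<not> (a = j \<and> b = i)"
  shows "compatible a (Suc a) b" "b < a \<Longrightarrow> compatible b a (Suc b)"
  using assms dist by (auto simp: compatible_def)

text \<open>Both counters only grow, so the corner is out of reach and i and j never meet.\<close>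

lemma adj_count_past_corner:
  assumes "dyck n a b p" "compatible v a b" "j < a \<or> i < b"
  shows "adj_count R (v # letters a b p) = adj_count S (v # letters a b p)"
  using assms
proof (induction n a b p arbitrary: v rule: dyck.induct)
  case (2 n a b p)
  have "compatible a (Suc a) b" using 2 compatible_step(1) by auto
  with 2 show ?case using compatible_agree(1) by auto
next
  case (3 n a b p)
  have "compatible b a (Suc b)" using 3 compatible_step(2) by auto
  with 3 show ?case using compatible_agree(2) by auto
qed auto

text \<open>The next letter is j + 1 or i + 1. Since i + 2 \<le> j it is neither i nor j, so
  \<open>twins\<close> makes the preceding i and j interchangeable.\<close>

lemma adj_count_after_corner:
  assumes "dyck n (Suc j) (Suc i) p" "{v, w} = {i, j}"
  shows "adj_count R (v # letters (Suc j) (Suc i) p) = adj_count S (w # letters (Suc j) (Suc i) p)"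
proof -
  have "adj_count R (v # letters (Suc j) (Suc i) p) = adj_count R (w # letters (Suc j) (Suc i) p)"
  proof (cases p)
    case (Cons x q)
    have "R v (Suc j) = R w (Suc j)" "R v (Suc i) = R w (Suc i)"
      using twins[of "Suc j"] twins[of "Suc i"] dist assms(2) by (auto simp: doubleton_eq_iff)
    then show ?thesis using Cons by (cases x) auto
  qed simp
  also have "\<dots> = adj_count S (w # letters (Suc j) (Suc i) p)"
    using assms dist by (intro adj_count_past_corner) (auto simp: compatible_def doubleton_eq_iff)
  finally show ?thesis .
qed

lemma adj_count_swap_corner:
  assumes "dyck n a b p" "compatible v a b"
  shows "adj_count R (v # letters a b p) = adj_count S (v # letters a b (swap_corner i j a b p))"
  using assms
proof (induction p arbitrary: v a b rule: induct_list012)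
  case (2 x)
  then show ?case using compatible_agree by (cases x) auto
next
  case (3 x y p)
  show ?case
  proof (cases "a = j \<and> b = i")
    case False
    then show ?thesis
      using 3(2)[of "Suc a" b a] 3(2)[of a "Suc b" b] 3(3-) compatible_agree compatible_step
      by (cases x) auto
  next
    case True
    \<comment> \<open>The letter v is j - 1 or i - 1.\<close>
    then have v: "v \<noteq> i" "v \<noteq> j" using 3(4) dist by (auto simp: compatible_def)
    then have v': "R v j = S v i" "R v i = S v j" "R v j = S v j" "R v i = S v i"
      using twins[of v] agree by auto
    show ?thesis
    proof (cases "x = y")
      case eq: True
      have "adj_count R (v # letters a b (x # y # p)) = adj_count S (v # letters a b (x # y # p))"
      proof (cases x)
        case x: True
        have "compatible (Suc j) (Suc (Suc j)) i" using dist by (auto simp: compatible_def)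
        moreover have "R j (Suc j) = S j (Suc j)" using dist by (intro agree) auto
        ultimately show ?thesis
          using 3(3) x eq True v' adj_count_past_corner[of n "Suc (Suc j)" i p "Suc j"] by simp
      next
        case x: False
        then have "compatible (Suc i) j (Suc (Suc i))"
          using dist True eq 3(3) by (auto simp: compatible_def)
        moreover have "R i (Suc i) = S i (Suc i)" using dist by (intro agree) auto
        ultimately show ?thesis
          using 3(3) x eq True v' adj_count_past_corner[of n j "Suc (Suc i)" p "Suc i"] by simp
      qed
      then show ?thesis using True eq by simp
    next
      \<comment> \<open>One path writes i j and the other j i: \<open>swapped\<close> matches this
        pair, and \<open>twins\<close> its two neighbours.\<close>
      case False
      then show ?thesis
        using 3(3) True v' swapped adj_count_after_corner[of n p i j] adj_count_after_corner[of n p j i]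
        by (cases x) auto
    qed
  qed
qed simp

lemma adj_count_dyck_swap_corner:
  assumes "dyck n 0 0 p"
  shows "adj_count R (letters 0 0 p) = adj_count S (letters 0 0 (swap_corner i j 0 0 p))"
proof (cases p)
  case (Cons x q)
  with assms have x: "x" by (cases x) auto
  have sc: "swap_corner i j 0 0 p = True # swap_corner i j 1 0 q"
    using Cons x dist by (cases q) auto
  have "compatible 0 1 0" using dist by (auto simp: compatible_def)
  then show ?thesis
    using adj_count_swap_corner[of n 1 0 q 0] assms Cons x unfolding sc by simp
qed simp

end

section \<open>Rearranging the positions sorted by value\<close>

fun after :: "'a list \<Rightarrow> 'a \<Rightarrow> 'a \<Rightarrow> bool" where
  "after [] x y \<longleftrightarrow> False"
| "after (z # \<tau>) x y \<longleftrightarrow> (y = z \<and> x \<in> set \<tau>) \<or> after \<tau> x y"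

lemma after_in_set: "after \<tau> x y \<Longrightarrow> x \<in> set \<tau> \<and> y \<in> set \<tau>"
  by (induction \<tau>) auto

lemma after_append:
  "after (\<alpha> @ \<beta>) x y \<longleftrightarrow> after \<alpha> x y \<or> after \<beta> x y \<or> (x \<in> set \<beta> \<and> y \<in> set \<alpha>)"
  by (induction \<alpha>) auto

lemma after_sorted:
  assumes "sorted (map f \<tau>)" "distinct (map f \<tau>)" "x \<in> set \<tau>" "y \<in> set \<tau>"
  shows "after \<tau> x y \<longleftrightarrow> f x > f y"
  using assms
proof (induction \<tau>)
  case (Cons z \<tau>)
  have "\<not> after \<tau> z y" "\<not> after \<tau> x z" using Cons.prems(2) after_in_set by force+
  with Cons show ?case by (auto simp: image_iff order_less_le)
qed simp

lemma adj_count_upt_cong: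
  assumes "\<And>x. R x (Suc x) = S x (Suc x)"
  shows "adj_count R [a..<b] = adj_count S [a..<b]"
proof (induction "b - a" arbitrary: a)
  case (Suc k)
  then show ?case
  proof (cases "Suc a < b")
    case True
    then have "[a..<b] = a # Suc a # [Suc (Suc a)..<b]" "[Suc a..<b] = Suc a # [Suc (Suc a)..<b]"
      by (simp_all add: upt_conv_Cons)
    with Suc(1)[of "Suc a"] Suc(2) assms show ?thesis by simp
  next
    case False
    with Suc(2) have "[a..<b] = [a]" by (simp add: upt_conv_Cons)
    then show ?thesis by simp
  qed
qed simp

text \<open>If \<open>\<tau>\<close> lists the positions of \<open>\<sigma>\<close> by increasing value, then \<open>\<sigma>\<close> has a larger value at
  \<open>x\<close> than at \<open>y\<close> exactly if \<open>after \<tau> x y\<close>; hence \<open>excess n \<tau> r\<close> encodes the nonnesting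
  permutations over \<open>\<sigma>\<close> with \<open>r\<close> more descents than \<open>\<sigma>\<close>.\<close>

definition excess :: "nat \<Rightarrow> nat list \<Rightarrow> int \<Rightarrow> bool list set" where
  "excess n \<tau> r = {p. dyck n 0 0 p \<and>
     int (adj_count (after \<tau>) (letters 0 0 p)) - int (adj_count (after \<tau>) [0..<n]) = r}"

text \<open>Neighbours in \<tau> are positions of consecutive values, so this is the first of the
  two moves; the involution \<open>swap_corner\<close> matches the two sets.\<close>

lemma card_excess_swap_less:
  assumes dist: "i + 2 \<le> j" and ij: "{k, l} = {i, j}" and "distinct (\<alpha> @ k # l # \<beta>)"
  shows "card (excess n (\<alpha> @ k # l # \<beta>) r) = card (excess n (\<alpha> @ l # k # \<beta>) r)"
proof -
  define R where "R = after (\<alpha> @ k # l # \<beta>)"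
  define S where "S = after (\<alpha> @ l # k # \<beta>)"
  have notin: "k \<notin> set \<alpha>" "k \<notin> set \<beta>" "l \<notin> set \<alpha>" "l \<notin> set \<beta>" "k \<noteq> l"
    using assms(3) by auto
  have "\<not> after \<alpha> k x" "\<not> after \<alpha> l x" "\<not> after \<beta> k x" "\<not> after \<beta> l x"
    "\<not> after \<alpha> x k" "\<not> after \<alpha> x l" "\<not> after \<beta> x k" "\<not> after \<beta> x l" for x
    using notin after_in_set by metis+
  note [simp] = this notin notin(5)[symmetric]
  have agree: "R x y = S x y" if "\<not> (x = k \<and> y = l)" "\<not> (x = l \<and> y = k)" for x y
    using that by (auto simp: R_def S_def after_append)
  have twins: "R x k = R x l \<and> R k x = R l x" "S x k = S x l \<and> S k x = S l x"
    if "x \<noteq> k" "x \<noteq> l" for x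
    using that by (simp_all add: R_def S_def after_append)
  have swapped: "R k l = S l k" "R l k = S k l"
    by (simp_all add: R_def S_def after_append)
  have kl: "k = i \<and> l = j \<or> k = j \<and> l = i" using ij by (auto simp: doubleton_eq_iff)
  interpret RS: distant_swap R S i j
    by unfold_locales (use dist kl agree twins swapped in metis)+
  interpret SR: distant_swap S R i j
    by unfold_locales (use dist kl agree twins swapped in metis)+
  \<comment> \<open>The descents of \<sigma> itself compare only adjacent positions, which i and j
    are not.\<close>
  have upt: "adj_count R [0..<n] = adj_count S [0..<n]"
    using dist by (intro adj_count_upt_cong RS.agree) auto
  have "i < j" using dist by simp
  show ?thesis
    unfolding excess_def R_def[symmetric] S_def[symmetric]
    by (intro bij_betw_same_card[OF bij_betw_byWitness[where f = "swap_corner i j 0 0" and f' = "swap_corner i j 0 0"]])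
      (auto simp: upt dyck_swap_corner[OF \<open>i < j\<close>]
        RS.adj_count_dyck_swap_corner[symmetric] SR.adj_count_dyck_swap_corner[symmetric])
qed

section \<open>Commuting distant positions\<close>

definition distant :: "nat \<Rightarrow> nat \<Rightarrow> bool" where
  "distant i j \<longleftrightarrow> i + 2 \<le> j \<or> j + 2 \<le> i"

lemma card_excess_swap:
  "distant i j \<Longrightarrow> distinct (\<alpha> @ i # j # \<beta>) \<Longrightarrow>
    card (excess n (\<alpha> @ i # j # \<beta>) r) = card (excess n (\<alpha> @ j # i # \<beta>) r)"
  using card_excess_swap_less[of i j i j] card_excess_swap_less[of j i i j]
  by (auto simp: distant_def insert_commute)

lemma card_excess_swap_list:
  "\<forall>y \<in> set \<beta>. distant x y \<Longrightarrow> distinct (\<alpha> @ x # \<beta> @ \<gamma>) \<Longrightarrow>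
    card (excess n (\<alpha> @ x # \<beta> @ \<gamma>) r) = card (excess n (\<alpha> @ \<beta> @ x # \<gamma>) r)"
proof (induction \<beta> arbitrary: \<alpha>)
  case (Cons y \<beta>)
  then show ?case
    using card_excess_swap[of x y \<alpha> "\<beta> @ \<gamma>" n r] Cons.IH[of "\<alpha> @ [y]"] by auto
qed simp

lemma card_excess_swap_lists:
  "\<forall>x \<in> set \<beta>. \<forall>y \<in> set \<gamma>. distant x y \<Longrightarrow> distinct (\<alpha> @ \<beta> @ \<gamma> @ \<delta>) \<Longrightarrow>
    card (excess n (\<alpha> @ \<beta> @ \<gamma> @ \<delta>) r) = card (excess n (\<alpha> @ \<gamma> @ \<beta> @ \<delta>) r)"
proof (induction \<beta> arbitrary: \<alpha>)
  case (Cons x \<beta>)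
  have "card (excess n ((\<alpha> @ [x]) @ \<beta> @ \<gamma> @ \<delta>) r) = card (excess n ((\<alpha> @ [x]) @ \<gamma> @ \<beta> @ \<delta>) r)"
    using Cons.prems by (intro Cons.IH) auto
  moreover have "card (excess n (\<alpha> @ x # \<gamma> @ \<beta> @ \<delta>) r) = card (excess n (\<alpha> @ \<gamma> @ x # \<beta> @ \<delta>) r)"
    using Cons.prems by (intro card_excess_swap_list) auto
  ultimately show ?case by simp
qed simp

text \<open>Making the largest letter \<open>m\<close> the smallest one trades the descents leaving a run of \<open>m\<close>
  for the ones entering it, so only the two ends of the word matter.\<close>

lemma adj_count_rotate:
  assumes "m \<notin> set \<alpha>" "xs \<noteq> []" "set xs \<subseteq> insert m (set \<alpha>)"
  shows "adj_count (after (\<alpha> @ [m])) xs + of_bool (last xs = m) =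
         adj_count (after (m # \<alpha>)) xs + of_bool (hd xs = m)"
proof -
  have [simp]: "\<not> after \<alpha> m x" "\<not> after \<alpha> x m" for x
    using assms(1) after_in_set by metis+
  show ?thesis
    using assms(2,3) by (induction xs rule: induct_list012) (auto simp: after_append)
qed

lemma last_letters: "dyck n a b p \<Longrightarrow> p \<noteq> [] \<Longrightarrow> last (letters a b p) = n - 1"
proof (induction n a b p rule: dyck.induct)
  case (2 n a b p)
  then show ?case by (cases "p = []") auto
next
  case (3 n a b p)
  then show ?case by (cases "p = []") auto
qed simp

lemma excess_rotate1:
  assumes "distinct (m # \<alpha>)" "set (m # \<alpha>) = {..<n}"
  shows "excess n (m # \<alpha>) r = excess n (\<alpha> @ [m]) r"
proof -
  have n: "n > 0" using assms(2) by (cases n) simp_all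
  \<comment> \<open>The correction depends only on the first letter 0 and the last letter n - 1.
    These are common to \<open>[0..<n]\<close> and to every path word, so it cancels in the
    difference.\<close>
  have rotate: "int (adj_count (after (\<alpha> @ [m])) xs) + of_bool (n - 1 = m) =
      int (adj_count (after (m # \<alpha>)) xs) + of_bool (0 = m)"
    if "xs \<noteq> []" "set xs = {..<n}" "hd xs = 0" "last xs = n - 1" for xs
  proof -
    have "adj_count (after (\<alpha> @ [m])) xs + of_bool (last xs = m) =
        adj_count (after (m # \<alpha>)) xs + of_bool (hd xs = m)"
      using that(1,2) assms by (intro adj_count_rotate) simp_all
    from arg_cong[OF this, of int] show ?thesis by (simp add: that(3,4))
  qed
  have "hd [0..<n] = 0" "last [0..<n] = n - 1" using n by simp_all
  then have upt: "int (adj_count (after (\<alpha> @ [m])) [0..<n]) + of_bool (n - 1 = m) =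
      int (adj_count (after (m # \<alpha>)) [0..<n]) + of_bool (0 = m)"
    using n by (intro rotate) auto
  have "int (adj_count (after (m # \<alpha>)) (letters 0 0 p)) - int (adj_count (after (m # \<alpha>)) [0..<n]) =
      int (adj_count (after (\<alpha> @ [m])) (letters 0 0 p)) - int (adj_count (after (\<alpha> @ [m])) [0..<n])"
    if p: "dyck n 0 0 p" for p
  proof -
    have "p \<noteq> []" using p n by auto
    then have "hd (letters 0 0 p) = 0" using p by (cases p; cases "hd p") auto
    moreover have "set (letters 0 0 p) = {..<n}" using p by (auto simp: dyck_iff set_letters)
    ultimately show ?thesis
      using rotate[of "letters 0 0 p"] upt last_letters[OF p \<open>p \<noteq> []\<close>] \<open>p \<noteq> []\<close> by simp
  qed
  then show ?thesis unfolding excess_def by (intro Collect_cong conj_cong refl) simp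
qed

lemma excess_rotate:
  "distinct (\<alpha> @ \<beta>) \<Longrightarrow> set (\<alpha> @ \<beta>) = {..<n} \<Longrightarrow> excess n (\<alpha> @ \<beta>) r = excess n (\<beta> @ \<alpha>) r"
proof (induction \<alpha> arbitrary: \<beta>)
  case (Cons m \<alpha>)
  have "set (\<alpha> @ \<beta> @ [m]) = set ((m # \<alpha>) @ \<beta>)" by auto
  then have "set (\<alpha> @ \<beta> @ [m]) = {..<n}" using Cons.prems(2) by (rule trans)
  moreover have "distinct (\<alpha> @ \<beta> @ [m])" using Cons.prems(1) by auto
  ultimately have "excess n (\<alpha> @ \<beta> @ [m]) r = excess n ((\<beta> @ [m]) @ \<alpha>) r"
    by (intro Cons.IH)
  moreover have "excess n (m # \<alpha> @ \<beta>) r = excess n ((\<alpha> @ \<beta>) @ [m]) r"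
    using Cons.prems by (intro excess_rotate1) simp_all
  ultimately show ?case by simp
qed simp

text \<open>Grows the decreasing tail one position at a time. Write \<alpha> as \<alpha>1, m,
  \<alpha>2. Entries of \<alpha>2 exceed m, so they are distant from all positions below m, and the
  tail moves left past \<alpha>2 until it follows m. Rotating \<alpha>2 to the front leaves a tail
  that starts with m.\<close>

lemma card_excess_rev_upt:
  assumes "m \<le> n" "distinct \<alpha>" "set \<alpha> = {m..<n}"
  shows "card (excess n (\<alpha> @ rev [0..<m]) r) = card (excess n (rev [0..<n]) r)"
  using assms
proof (induction "n - m" arbitrary: m \<alpha>)
  case (Suc k)
  have "m \<in> set \<alpha>" unfolding Suc.prems(3) using Suc(2) by simp
  from split_list[OF this] obtain \<alpha>\<^sub>1 \<alpha>\<^sub>2 where \<alpha>: "\<alpha> = \<alpha>\<^sub>1 @ m # \<alpha>\<^sub>2" by blast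
  have set: "set \<alpha>\<^sub>1 \<union> set \<alpha>\<^sub>2 = {Suc m..<n}"
  proof -
    have "set \<alpha>\<^sub>1 \<union> set \<alpha>\<^sub>2 = set \<alpha> - {m}" using Suc.prems(2) unfolding \<alpha> by auto
    also have "\<dots> = {Suc m..<n}" unfolding Suc.prems(3) by auto
    finally show ?thesis .
  qed
  have gt: "\<forall>x \<in> set \<alpha>\<^sub>1 \<union> set \<alpha>\<^sub>2. m < x" unfolding set by simp
  have ge: "x \<notin> set \<alpha>\<^sub>1" "x \<notin> set \<alpha>\<^sub>2" if "x < m" for x
    using gt that by (meson UnI1 UnI2 less_asym)+
  have far: "distant x y" if "x \<in> set \<alpha>\<^sub>2" "y < m" for x y
  proof -
    have "m < x" using gt that(1) by blast
    with that(2) show ?thesis by (simp add: distant_def)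
  qed
  have dist: "distinct ((\<alpha>\<^sub>1 @ m # rev [0..<m]) @ \<alpha>\<^sub>2)"
    using Suc.prems(2) unfolding \<alpha> by (auto simp: ge)
  have cover: "set ((\<alpha>\<^sub>1 @ m # rev [0..<m]) @ \<alpha>\<^sub>2) = {..<n}"
  proof -
    have "set ((\<alpha>\<^sub>1 @ m # rev [0..<m]) @ \<alpha>\<^sub>2) = insert m ({..<m} \<union> (set \<alpha>\<^sub>1 \<union> set \<alpha>\<^sub>2))" by auto
    also have "\<dots> = {..<n}" unfolding set using Suc(2) by (intro set_eqI) (simp, linarith)
    finally show ?thesis .
  qed
  have "card (excess n (\<alpha> @ rev [0..<m]) r) = card (excess n ((\<alpha>\<^sub>1 @ [m]) @ \<alpha>\<^sub>2 @ rev [0..<m] @ []) r)"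
    by (simp add: \<alpha>)
  also have "\<dots> = card (excess n ((\<alpha>\<^sub>1 @ [m]) @ rev [0..<m] @ \<alpha>\<^sub>2 @ []) r)"
    using dist by (intro card_excess_swap_lists) (auto intro: far)
  also have "\<dots> = card (excess n ((\<alpha>\<^sub>2 @ \<alpha>\<^sub>1) @ rev [0..<Suc m]) r)"
    using excess_rotate[OF dist cover] by simp
  also have "\<dots> = card (excess n (rev [0..<n]) r)"
  proof (rule Suc(1))
    show "distinct (\<alpha>\<^sub>2 @ \<alpha>\<^sub>1)" using dist by auto
    show "set (\<alpha>\<^sub>2 @ \<alpha>\<^sub>1) = {Suc m..<n}" using set by (simp add: Un_commute)
  qed (use Suc(2) in simp_all)
  finally show ?case .
qed simp

lemma card_excess_eq:
  assumes "distinct \<tau>" "set \<tau> = {..<n}"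
  shows "card (excess n \<tau> r) = card (excess n (rev [0..<n]) r)"
  using card_excess_rev_upt[of 0 n \<tau> r] assms by (simp add: lessThan_atLeast0)

section \<open>Narayana numbers\<close>

fun peaks :: "bool list \<Rightarrow> nat" where
  "peaks [] = 0"
| "peaks (False # p) = peaks p"
| "peaks (True # p) = peaks p + of_bool (p \<noteq> [] \<and> \<not> hd p)"

text \<open>Two equal steps write consecutive letters, and a valley writes b before a with b < a.
  Only a peak, writing a before b \<le> a, fails to increase.\<close>

lemma adj_count_less_letters:
  "dyck n a b p \<Longrightarrow> p \<noteq> [] \<Longrightarrow> adj_count (<) (letters a b p) + peaks p + 1 = length p"
proof (induction p arbitrary: a b rule: induct_list012)
  case (2 x)
  then show ?case by (cases x) auto
next
  case (3 x y p)
  then show ?case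
    using 3(2)[of "Suc a" b] 3(2)[of a "Suc b"] by (cases x; cases y) auto
qed simp

section \<open>Counting paths recursively by the first step\<close>

lemma card_dyck_step:
  "card {p. dyck n a b p \<and> P p} =
     of_bool (a = n \<and> b = n \<and> P []) + card {p. dyck n (Suc a) b p \<and> P (True # p)} +
     (if b < a then card {p. dyck n a (Suc b) p \<and> P (False # p)} else 0)"
proof -
  let ?E = "if a = n \<and> b = n \<and> P [] then {[]} else {}"
  let ?T = "{p. dyck n (Suc a) b p \<and> P (True # p)}"
  let ?F = "if b < a then {p. dyck n a (Suc b) p \<and> P (False # p)} else {}"
  have eq: "{p. dyck n a b p \<and> P p} = ?E \<union> (#) True ` ?T \<union> (#) False ` ?F"
  proof (rule set_eqI)
    fix p
    show "p \<in> {p. dyck n a b p \<and> P p} \<longleftrightarrow> p \<in> ?E \<union> (#) True ` ?T \<union> (#) False ` ?F"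
      by (cases "(n, a, b, p)" rule: dyck.cases) auto
  qed
  have fin: "finite ?T" "finite ?F"
    using finite_dyck[of n "Suc a" b] finite_dyck[of n a "Suc b"] by simp_all
  have "card {p. dyck n a b p \<and> P p} = card ?E + card ?T + card ?F"
    unfolding eq using fin by (subst card_Un_disjoint, simp, simp, force)+ (simp add: card_image)
  also have "card ?E = of_bool (a = n \<and> b = n \<and> P [])" by simp
  also have "card ?F = (if b < a then card {p. dyck n a (Suc b) p \<and> P (False # p)} else 0)" by simp
  finally show ?thesis .
qed

lemma card_dyck_gt: "b \<le> a \<Longrightarrow> n < a \<Longrightarrow> card {p. dyck n a b p \<and> P p} = 0"
  using dyck_le by (auto simp: card_eq_0_iff) fastforce

text \<open>Reflection-principle counts of the paths with \<open>i\<close> first and \<open>j\<close> second copies left to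
  write and \<open>k\<close> peaks. Directly after a \<open>True\<close> step, where the current point may itself become a
  peak, the indices are shifted: \<open>count_after_True i j k\<close> stands for \<open>j + 1\<close> second copies and
  \<open>k + 1\<close> peaks.\<close>

definition count_after_False :: "nat \<Rightarrow> nat \<Rightarrow> nat \<Rightarrow> int" where
  "count_after_False i j k = (case i of
      0 \<Rightarrow> of_bool (k = 0)
    | Suc i' \<Rightarrow> (case k of 0 \<Rightarrow> 0
        | Suc k' \<Rightarrow> int (i' choose k') * int (j choose Suc k') - int (i' choose Suc k') * int (j choose k')))"

definition count_after_True :: "nat \<Rightarrow> nat \<Rightarrow> nat \<Rightarrow> int" where
  "count_after_True i j k = int (i choose k) * int (j choose k)
     - int (i choose Suc k) * (int (Suc j choose k) - int (j choose k))"

text \<open>Pascal's rule in the form of a split by the next step: a \<open>False\<close> step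
  closes a peak, which absorbs the shift of k.\<close>

lemma count_after_True_rec:
  "count_after_True i j k = (if i = 0 then 0 else count_after_True (i - 1) j k) + count_after_False i j k"
  by (cases i; cases k) (auto simp: count_after_True_def count_after_False_def algebra_simps)

lemma count_after_False_rec:
  "count_after_False (Suc i) (Suc j) (Suc k) = count_after_True i j k + count_after_False (Suc i) j (Suc k)"
  by (simp add: count_after_True_def count_after_False_def algebra_simps)

text \<open>The boundary condition just beyond the diagonal: the reflected term cancels the main
  one, so a forbidden down step contributes 0.\<close>

lemma count_after_False_diag: "count_after_False (Suc i) i k = 0"
  by (cases k) (auto simp: count_after_False_def)

lemma card_dyck_step_left:
  assumes "a + i = n" "b + j = n" "i \<le> j"
  shows "card {p. dyck n a b p \<and> P p} = of_bool (j = 0 \<and> P []) +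
      (if i = 0 then 0 else card {p. dyck n (Suc a) b p \<and> P (True # p)}) +
      (if i < j then card {p. dyck n a (Suc b) p \<and> P (False # p)} else 0)"
  using assms card_dyck_gt[of b "Suc a" n "\<lambda>p. P (True # p)"]
  unfolding card_dyck_step[of n a b P] by auto

text \<open>The prefixed \<open>True\<close> is the step just taken, whose peak depends on what
  follows. After it the path is above the diagonal, i < j, and must still descend, so at least one
  peak occurs.\<close>

lemma card_dyck_peaks:
  assumes "a + i = n" "b + j = n" "i \<le> j"
  shows "int (card {p. dyck n a b p \<and> peaks p = k}) = count_after_False i j k"
    and "i < j \<Longrightarrow> int (card {p. dyck n a b p \<and> peaks (True # p) = Suc k}) = count_after_True i (j - 1) k"
    and "i < j \<Longrightarrow> card {p. dyck n a b p \<and> peaks (True # p) = 0} = 0"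
  using assms
proof (induction "i + j" arbitrary: i j a b k rule: less_induct)
  case less
  note IH = less.hyps
  {
    case 1
    note step = card_dyck_step_left[OF 1]
    show ?case
    proof (cases i)
      case 0
      show ?thesis
      proof (cases j)
        case (Suc j')
        with 0 1 IH(1)[of 0 j' a "Suc b" k] show ?thesis
          unfolding step[of "\<lambda>p. peaks p = k"] by (simp add: count_after_False_def)
      qed (use 0 in \<open>auto simp: step count_after_False_def\<close>)
    next
      case (Suc i')
      then obtain j' where j: "j = Suc j'" using 1 by (cases j) auto
      have F: "int (if i < j then card {p. dyck n a (Suc b) p \<and> peaks (False # p) = k} else 0) =
          count_after_False i j' k"
      proof (cases "i < j")
        case True
        with Suc j 1 IH(1)[of i j' a "Suc b" k] show ?thesis by simp
      next
        case False
        then have "i' = j'" using Suc j 1 by simp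
        with False show ?thesis by (simp add: count_after_False_diag Suc)
      qed
      have T: "int (card {p. dyck n (Suc a) b p \<and> peaks (True # p) = k}) =
          (case k of 0 \<Rightarrow> 0 | Suc k' \<Rightarrow> count_after_True i' j' k')"
        using Suc j 1 IH(2)[of i' j "Suc a" b] IH(3)[of i' j "Suc a" b]
        by (cases k) auto
      have "int (card {p. dyck n a b p \<and> peaks p = k}) =
          int (card {p. dyck n (Suc a) b p \<and> peaks (True # p) = k}) +
          int (if i < j then card {p. dyck n a (Suc b) p \<and> peaks (False # p) = k} else 0)"
        unfolding step[of "\<lambda>p. peaks p = k"] using Suc j by simp
      also have "\<dots> = count_after_False i j k"
        unfolding F T using Suc j count_after_False_rec
        by (cases k) (auto simp: count_after_False_def)
      finally show ?thesis .
    qed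
  next
    case 2
    note step = card_dyck_step_left[OF 2(2-4)]
    from 2 obtain j' where j: "j = Suc j'" by (cases j) auto
    have "int (card {p. dyck n a (Suc b) p \<and> peaks (True # False # p) = Suc k}) = count_after_False i j' k"
      using 2 j IH(1)[of i j' a "Suc b" k] by simp
    moreover have "int (card {p. dyck n (Suc a) b p \<and> peaks (True # True # p) = Suc k}) =
        count_after_True (i - 1) j' k" if "i \<noteq> 0"
      using that 2 j IH(2)[of "i - 1" j "Suc a" b k] by (cases i) simp_all
    ultimately show ?case
      unfolding step[of "\<lambda>p. peaks (True # p) = Suc k"] count_after_True_rec[of i "j - 1"]
      using j 2 by simp
  next
    case 3
    note step = card_dyck_step_left[OF 3(2-4)]
    have "card {p. dyck n (Suc a) b p \<and> peaks (True # True # p) = 0} = 0" if "i \<noteq> 0"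
      using that 3 IH(3)[of "i - 1" j "Suc a" b] by (cases i) simp_all
    then show ?case
      unfolding step[of "\<lambda>p. peaks (True # p) = 0"] using 3 by simp
  }
qed

lemma count_after_False_symmetric:
  assumes "k \<le> m"
  shows "count_after_False (Suc m) (Suc m) (Suc k) = count_after_False (Suc m) (Suc m) (Suc (m - k))"
proof -
  have 1: "m choose (m - k) = m choose k" "Suc m choose Suc (m - k) = Suc m choose k"
    "Suc m choose (m - k) = Suc m choose Suc k"
    using assms binomial_symmetric[of k m] binomial_symmetric[of k "Suc m"] binomial_symmetric[of "Suc k" "Suc m"]
    by (simp_all add: Suc_diff_le)
  \<comment> \<open>For k > 0 this is m choose (k - 1); the difference form covers k = 0 as
    well.\<close>
  have 2: "int (m choose Suc (m - k)) = int (Suc m choose k) - int (m choose k)"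
    using 1(1,2) by (simp add: algebra_simps)
  have 3: "int (Suc m choose Suc k) = int (m choose k) + int (m choose Suc k)" by simp
  show ?thesis
    unfolding count_after_False_def nat.case 1 2 3 by (simp only: algebra_simps)
qed

lemma card_dyck_peaks_symmetric:
  assumes "n \<ge> 1"
  shows "card {p. dyck n 0 0 p \<and> int (peaks p) = z} = card {p. dyck n 0 0 p \<and> int (peaks p) = int n + 1 - z}"
proof -
  obtain m where n: "n = Suc m" using assms by (cases n) auto
  have count: "int (card {p. dyck n 0 0 p \<and> int (peaks p) = int k}) = count_after_False (Suc m) (Suc m) k" for k
    using card_dyck_peaks(1)[of 0 n n 0 n k] n by simp
  \<comment> \<open>Peak numbers lie in 1..n, a range that z \<mapsto> n + 1 - z preserves;
    elsewhere both sides are 0.\<close>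
  have outside: "card {p. dyck n 0 0 p \<and> int (peaks p) = z} = 0" if "z \<le> 0 \<or> int n < z" for z
  proof (cases "z < 0")
    case False
    then obtain k where k: "z = int k" by (metis int_ops(1) not_less zero_le_imp_eq_int)
    then have "count_after_False (Suc m) (Suc m) k = 0"
      using that n by (cases k) (auto simp: count_after_False_def binomial_eq_0)
    with count[of k] k show ?thesis by simp
  qed auto
  show ?thesis
  proof (cases "z \<le> 0 \<or> int n < z")
    case True
    then show ?thesis using outside[of z] outside[of "int n + 1 - z"] by auto
  next
    case False
    define k where "k = nat (z - 1)"
    have k: "z = int (Suc k)" "int n + 1 - z = int (Suc (m - k))" "k \<le> m"
      using False n by (auto simp: k_def)
    show ?thesis
      unfolding k(1,2)[symmetric] using count[of "Suc k"] count[of "Suc (m - k)"]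
        count_after_False_symmetric[OF k(3)] k(1,2) by simp
  qed
qed

section \<open>Symmetry of the descent distribution\<close>

lemma adj_count_less_upt: "adj_count (<) [a..<b] = b - a - 1"
proof (induction "b - a" arbitrary: a)
  case (Suc k)
  then show ?case
    using Suc(1)[of "Suc a"] by (cases "Suc a < b") (simp_all add: upt_conv_Cons)
qed simp

text \<open>For decreasing \<sigma> the descents are the increases of the letters: 2n - 1 -
  \<open>peaks p\<close> in the word and n - 1 in \<sigma>.\<close>

lemma card_excess_rev_upt_peaks:
  assumes "n \<ge> 1"
  shows "card (excess n (rev [0..<n]) r) = card {p. dyck n 0 0 p \<and> int (peaks p) = int n - r}"
proof -
  have after_iff: "after (rev [0..<n]) x y \<longleftrightarrow> x < y" if "x < n" "y < n" for x y
    using that by (induction n) (auto simp: less_Suc_eq dest: after_in_set)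
  have "adj_count (<) [0..<n] = n - 1"
    using adj_count_less_upt[of 0 n] by simp
  moreover have "adj_count (after (rev [0..<n])) [0..<n] = adj_count (<) [0..<n]"
    by (intro adj_count_cong after_iff) auto
  moreover have "int (adj_count (after (rev [0..<n])) (letters 0 0 p)) = 2 * int n - 1 - int (peaks p)"
    if p: "dyck n 0 0 p" for p
  proof -
    have "set (letters 0 0 p) = {..<n}" using p by (auto simp: dyck_iff set_letters)
    then have "adj_count (after (rev [0..<n])) (letters 0 0 p) = adj_count (<) (letters 0 0 p)"
      by (intro adj_count_cong after_iff) auto
    moreover have "length p = 2 * n" using length_dyck[OF p] by simp
    moreover from this have "p \<noteq> []" using assms by auto
    ultimately show ?thesis using adj_count_less_letters[OF p] by simp
  qed
  ultimately show ?thesis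
    unfolding excess_def using assms
    by (intro arg_cong[where f = card] Collect_cong conj_cong refl) auto
qed

lemma card_descents_eq_card_excess:
  assumes "\<sigma> \<in> permutations_of_set {1..n}"
  shows "card {\<pi> \<in> nonnesting_perms_over n \<sigma>. int (des \<pi>) - int (des \<sigma>) = r} =
         card (excess n (rev [0..<n]) r)"
proof -
  have \<sigma>: "set \<sigma> = {1..n}" "distinct \<sigma>" using assms by (auto simp: permutations_of_set_def)
  then have len: "length \<sigma> = n" using distinct_card by fastforce
  \<comment> \<open>This is the inverse permutation of \<sigma>, with positions counted from
    0.\<close>
  define \<tau> where "\<tau> = sort_key ((!) \<sigma>) [0..<n]"
  have \<tau>: "set \<tau> = {..<n}" "distinct \<tau>" "sorted (map ((!) \<sigma>) \<tau>)"
    by (auto simp: \<tau>_def)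
  have "inj_on ((!) \<sigma>) (set \<tau>)"
    using \<sigma> len \<tau>(1) by (auto simp: inj_on_def nth_eq_iff_index_eq)
  then have after_iff: "after \<tau> x y \<longleftrightarrow> \<sigma> ! x > \<sigma> ! y" if "x < n" "y < n" for x y
    using that \<tau> by (intro after_sorted) (auto simp: distinct_map)
  define f where "f p = map ((!) \<sigma>) (letters 0 0 p)" for p
  have bij: "bij_betw f {p. dyck n 0 0 p} (nonnesting_perms_over n \<sigma>)"
    unfolding f_def by (rule bij_betw_dyck_nonnesting_perms_over[OF assms])
  have "des (map ((!) \<sigma>) [0..<n]) = adj_count (after \<tau>) [0..<n]"
    unfolding des_map_eq_adj_count by (intro adj_count_cong) (auto simp: after_iff)
  then have des\<sigma>: "des \<sigma> = adj_count (after \<tau>) [0..<n]"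
    using map_nth[of \<sigma>] len by simp
  have desf: "des (f p) = adj_count (after \<tau>) (letters 0 0 p)" if p: "dyck n 0 0 p" for p
  proof -
    have "set (letters 0 0 p) = {..<n}" using p by (auto simp: dyck_iff set_letters)
    then show ?thesis
      unfolding f_def des_map_eq_adj_count by (intro adj_count_cong) (auto simp: after_iff)
  qed
  have "bij_betw f (excess n \<tau> r) {\<pi> \<in> nonnesting_perms_over n \<sigma>. int (des \<pi>) - int (des \<sigma>) = r}"
  proof (rule bij_betw_imageI)
    show "inj_on f (excess n \<tau> r)"
      using bij by (rule inj_on_subset[OF bij_betw_imp_inj_on]) (auto simp: excess_def)
    show "f ` excess n \<tau> r = {\<pi> \<in> nonnesting_perms_over n \<sigma>. int (des \<pi>) - int (des \<sigma>) = r}"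
      using bij_betw_imp_surj_on[OF bij, symmetric] by (auto simp: excess_def desf des\<sigma>)
  qed
  from bij_betw_same_card[OF this] show ?thesis
    unfolding card_excess_eq[OF \<tau>(2,1)] by (rule sym)
qed

theorem corollary2p8:
  fixes n :: nat and \<sigma> :: "nat list" and r :: int
  assumes "n \<ge> 1"
    and "\<sigma> \<in> permutations_of_set {1..n}"
  shows "card {\<pi> \<in> nonnesting_perms_over n \<sigma>. int (des \<pi>) - int (des \<sigma>) = r} =
         card {\<pi> \<in> nonnesting_perms_over n \<sigma>. int (des \<pi>) - int (des \<sigma>) = int n - 1 - r}"
  unfolding card_descents_eq_card_excess[OF assms(2)] card_excess_rev_upt_peaks[OF assms(1)]
  \<comment> \<open>For z = n - r the reflected value n + 1 - z is r + 1 = n - (n - 1 - r).\<close>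
  using card_dyck_peaks_symmetric[OF assms(1), of "int n - r"] by (simp add: algebra_simps)

end
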